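(* Let $r$ be a positive integer. Then \[ \sum_{k = 0}^\infty {\frac{1}{{\alpha ^{12rk} }}\left( {\frac{{\beta ^r }}{{12k + 1}} + \frac{{2\beta ^{3r} }}{{12k + 3}} + \frac{{\beta ^{5r} }}{{12k + 5}} - \frac{{\beta ^{7r} }}{{12k + 7}} - \frac{{2\beta ^{9r} }}{{12k + 9}} - \frac{{\beta ^{11r} }}{{12k + 11}}} \right)} = \begin{cases} - \arctan \left( \dfrac{1}{L_r } \right), & r \text{ odd}, \\[2mm] \arctan \left( \dfrac{1}{F_r \sqrt 5 } \right), & r \text{ even}. \end{cases} \]
   Context: $\alpha=(1+\sqrt5)/2$ is the golden ratio and $\beta=-1/\alpha=(1-\sqrt5)/2$. The Fibonacci and Lucas numbers are $F_n=(\alpha^n-\beta^n)/\sqrt5$ and $L_n=\alpha^n+\beta^n$. *)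

theory Defs
  imports "HOL-Analysis.Analysis" "HOL-Number_Theory.Fib"
begin

definition golden_alpha :: real where
  "golden_alpha = (1 + sqrt 5) / 2"

definition golden_beta :: real where
  "golden_beta = (1 - sqrt 5) / 2"

definition lucas :: "nat \<Rightarrow> real" where
  "lucas n = golden_alpha ^ n + golden_beta ^ n"

(* The Fibonacci numbers are the library's fib; this is Binet's formula in the present notation. *)
lemma fib_eq_Binet:
  "real (fib n) = (golden_alpha ^ n - golden_beta ^ n) / sqrt 5"
  using fib_closed_form[of n]
  by (simp add: golden_alpha_def golden_beta_def)

lemma golden_beta_eq: "golden_beta = - 1 / golden_alpha"
proof -
  have "1 + sqrt 5 > 0"
    by (auto intro: add_pos_pos)
  then have "golden_alpha \<noteq> 0"
    by (simp add: golden_alpha_def)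
  moreover have "golden_alpha * golden_beta = - 1"
    by (simp add: golden_alpha_def golden_beta_def field_simps)
  ultimately show ?thesis by (simp add: field_simps)
qed

end

theory Submission
  imports Defs
begin

text \<open>
  With x = \<beta>^r, the coefficient pattern 1, 2, 1, -1, -2, -1 is that of the arctangent series
  1, -1, 1, -1, 1, -1 plus 3, -3 at the odd multiples of 3, and the latter terms make up the
  series of arctan (x^3). The sum is therefore
  arctan x + arctan (x^3) = arctan (x / (1 - x^2)) = arctan (1 / (1/x - x)),
  where 1/x = (-\<alpha>)^r.
\<close>

text \<open>Stated with \<open>sums\<close> so that \<open>sums_group\<close> can collect
  consecutive terms into blocks.\<close>

lemma arctan_sums:
  fixes x :: real
  assumes "\<bar>x\<bar> \<le> 1"
  shows "(\<lambda>k. (- 1) ^ k * (1 / real (k * 2 + 1) * x ^ (k * 2 + 1))) sums arctan x"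
  using summable_arctan_series[OF assms] arctan_series[OF assms] by (simp add: sums_iff)

lemma sum_lessThan_6:
  fixes f :: "nat \<Rightarrow> 'a::comm_monoid_add"
  shows "sum f {m..<m + 6} = f m + f (m + 1) + f (m + 2) + f (m + 3) + f (m + 4) + f (m + 5)"
  by (simp add: eval_nat_numeral atLeastLessThanSuc add_ac)

text \<open>Six consecutive terms of the series at x and two of the series at x^3 both span the
  exponents 12k+1 to 12k+11. After grouping in this way the two series can be added block by
  block.\<close>

lemma arctan_plus_arctan_cube_sums:
  fixes x :: real
  assumes x: "\<bar>x\<bar> < 1"
  shows "(\<lambda>k. x ^ (12 * k) *
           (x / (12 * real k + 1) + 2 * x ^ 3 / (12 * real k + 3) + x ^ 5 / (12 * real k + 5)
            - x ^ 7 / (12 * real k + 7) - 2 * x ^ 9 / (12 * real k + 9)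
            - x ^ 11 / (12 * real k + 11)))
         sums (arctan x + arctan (x ^ 3))" (is "?f sums _")
proof -
  define g where "g y k = (- 1) ^ k * (1 / real (k * 2 + 1) * y ^ (k * 2 + 1))" for y :: real and k
  have x3: "\<bar>x ^ 3\<bar> \<le> 1"
    using x by (simp add: power_abs power_le_one)
  have "(\<lambda>n. sum (g x) {n * 6..<n * 6 + 6}) sums arctan x"
    using arctan_sums[of x] x by (intro sums_group) (simp_all add: g_def[abs_def])
  moreover have "(\<lambda>n. sum (g (x ^ 3)) {n * 2..<n * 2 + 2}) sums arctan (x ^ 3)"
    using arctan_sums[OF x3] by (intro sums_group) (simp_all add: g_def[abs_def])
  ultimately have "(\<lambda>n. sum (g x) {n * 6..<n * 6 + 6} + sum (g (x ^ 3)) {n * 2..<n * 2 + 2})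
      sums (arctan x + arctan (x ^ 3))"
    by (rule sums_add)
  also have "(\<lambda>n. sum (g x) {n * 6..<n * 6 + 6} + sum (g (x ^ 3)) {n * 2..<n * 2 + 2}) = ?f"
  proof
    fix n
    \<comment> \<open>A block starts at the even index 6n, so the sign depends on j alone, and
      doubling the index yields the common factor x^(12n).\<close>
    have g6: "g x (n * 6 + j) = x ^ (12 * n) * ((- 1) ^ j * x ^ (2 * j + 1) / (12 * real n + real (2 * j + 1)))"
      for j
    proof -
      have "(- 1 :: real) ^ (n * 6 + j) = (- 1) ^ j"
        by (simp add: power_add)
      moreover have "x ^ ((n * 6 + j) * 2 + 1) = x ^ (12 * n) * x ^ (2 * j + 1)"
        by (simp add: algebra_simps flip: power_add)
      moreover have "real ((n * 6 + j) * 2 + 1) = 12 * real n + real (2 * j + 1)"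
        by simp
      ultimately show ?thesis
        unfolding g_def by (simp only: times_divide_eq_right times_divide_eq_left mult_1_left mult.left_commute)
    qed
    have s6: "sum (g x) {n * 6..<n * 6 + 6} = x ^ (12 * n) *
        (x / (12 * real n + 1) - x ^ 3 / (12 * real n + 3) + x ^ 5 / (12 * real n + 5)
         - x ^ 7 / (12 * real n + 7) + x ^ 9 / (12 * real n + 9) - x ^ 11 / (12 * real n + 11))"
      unfolding sum_lessThan_6 using g6[of 0] g6[of 1] g6[of 2]
      by (simp add: g6 distrib_left right_diff_distrib)
    have "sum (g (x ^ 3)) {n * 2..<n * 2 + 2} = g (x ^ 3) (n * 2) + g (x ^ 3) (n * 2 + 1)"
      by (simp add: eval_nat_numeral atLeastLessThanSuc)
    \<comment> \<open>The coefficient 3 arises from expanding 1/(4n+1) to 3/(12n+3), which matches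
      the denominator of the x^3 term of the other block; likewise 1/(4n+3) becomes 3/(12n+9)
      below.\<close>
    also have "g (x ^ 3) (n * 2) = x ^ (12 * n) * (3 * x ^ 3 / (12 * real n + 3))"
    proof -
      have "(x ^ 3) ^ (n * 2 * 2 + 1) = x ^ (12 * n) * x ^ 3"
        by (simp add: add.commute flip: power_mult power_add)
      moreover have "1 / real (n * 2 * 2 + 1) = 3 / (12 * real n + 3)"
        by (simp add: field_simps)
      ultimately show ?thesis by (simp add: g_def)
    qed
    also have "g (x ^ 3) (n * 2 + 1) = - (x ^ (12 * n) * (3 * x ^ 9 / (12 * real n + 9)))"
    proof -
      have "(x ^ 3) ^ ((n * 2 + 1) * 2 + 1) = x ^ (12 * n) * x ^ 9"
        by (simp add: add.commute flip: power_mult power_add)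
      moreover have "1 / real ((n * 2 + 1) * 2 + 1) = 3 / (12 * real n + 9)"
        by (simp add: field_simps)
      ultimately show ?thesis by (simp add: g_def)
    qed
    finally have s2: "sum (g (x ^ 3)) {n * 2..<n * 2 + 2} = x ^ (12 * n) *
        (3 * x ^ 3 / (12 * real n + 3) - 3 * x ^ 9 / (12 * real n + 9))"
      by (simp add: right_diff_distrib)
    \<comment> \<open>At the odd multiples of 3 the coefficients combine as -1 + 3 = 2 and 1 - 3 =
      -2.\<close>
    show "sum (g x) {n * 6..<n * 6 + 6} + sum (g (x ^ 3)) {n * 2..<n * 2 + 2} = ?f n"
      unfolding s6 s2 distrib_left[symmetric]
      by (rule arg_cong[where f = "(*) _"]) (simp add: diff_divide_distrib)
  qed
  finally show ?thesis .
qed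

text \<open>Both arguments have absolute value below 1, so the addition formula holds without a
  shift by pi. Its denominator 1 - x^4 shares the positive factor 1 + x^2 with the
  numerator.\<close>

lemma arctan_plus_arctan_cube:
  fixes x :: real
  assumes x: "\<bar>x\<bar> < 1"
  shows "arctan x + arctan (x ^ 3) = arctan (x / (1 - x\<^sup>2))"
proof -
  have "\<bar>x ^ 3\<bar> < 1"
    using x by (simp add: power_abs power_less_one_iff)
  then have "arctan x + arctan (x ^ 3) = arctan ((x + x ^ 3) / (1 - x * x ^ 3))"
    using x by (intro arctan_add) simp_all
  also have "(x + x ^ 3) / (1 - x * x ^ 3) = (x * (1 + x\<^sup>2)) / ((1 - x\<^sup>2) * (1 + x\<^sup>2))"
    by (simp add: algebra_simps eval_nat_numeral)
  also have "\<dots> = x / (1 - x\<^sup>2)"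
    using zero_le_power2[of x] by (subst mult_divide_mult_cancel_right) (auto simp: add_nonneg_eq_0_iff)
  finally show ?thesis .
qed

lemma golden_alpha_pos: "golden_alpha > 0"
  by (simp add: golden_alpha_def add_pos_pos)

lemma golden_alpha_mult_beta: "golden_alpha * golden_beta = - 1"
  using golden_alpha_pos by (simp add: golden_beta_eq)

lemma abs_golden_beta_less_one: "\<bar>golden_beta\<bar> < 1"
proof -
  have "1 < sqrt (5::real)" "sqrt (5::real) < 3"
    by (auto intro: real_less_rsqrt real_less_lsqrt)
  then show ?thesis by (simp add: golden_beta_def abs_if)
qed

theorem theorem3p7:
  fixes r :: nat
  assumes "r > 0"
  shows "(\<lambda>k::nat. 1 / golden_alpha ^ (12 * r * k) *
           (golden_beta ^ r / (12 * real k + 1)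
            + 2 * golden_beta ^ (3 * r) / (12 * real k + 3)
            + golden_beta ^ (5 * r) / (12 * real k + 5)
            - golden_beta ^ (7 * r) / (12 * real k + 7)
            - 2 * golden_beta ^ (9 * r) / (12 * real k + 9)
            - golden_beta ^ (11 * r) / (12 * real k + 11)))
         sums (if odd r then - arctan (1 / lucas r)
               else arctan (1 / (real (fib r) * sqrt 5)))"
proof -
  define x where "x = golden_beta ^ r"
  have x: "\<bar>x\<bar> < 1"
    using assms abs_golden_beta_less_one by (simp add: x_def power_abs power_less_one_iff)
  have ax: "golden_alpha ^ r * x = (- 1) ^ r"
    by (simp add: x_def golden_alpha_mult_beta flip: power_mult_distrib)
  then have x0: "x \<noteq> 0" by auto
  \<comment> \<open>The exponent 12k is even, which removes the sign (-1)^r in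
    \<open>ax\<close>.\<close>
  have pow: "1 / golden_alpha ^ (12 * r * k) = x ^ (12 * k)" for k
  proof -
    have "golden_alpha ^ (12 * r * k) * x ^ (12 * k) = (golden_alpha ^ r * x) ^ (12 * k)"
      by (simp add: power_mult_distrib mult_ac flip: power_mult)
    also have "\<dots> = 1"
      by (simp add: ax flip: power_mult)
    finally show ?thesis
      using golden_alpha_pos by (simp add: field_simps)
  qed
  have beta: "golden_beta ^ (m * r) = x ^ m" for m
    by (simp add: x_def mult.commute flip: power_mult)
  have "x / (1 - x\<^sup>2) = 1 / ((- 1) ^ r * golden_alpha ^ r - x)"
  proof -
    have "(- 1) ^ r * golden_alpha ^ r = 1 / x"
      using ax x0 by (auto simp: field_simps uminus_power_if split: if_splits)
    moreover have "1 / x - x = (1 - x\<^sup>2) / x"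
      using x0 by (simp add: power2_eq_square diff_divide_distrib)
    ultimately show ?thesis by simp
  qed
  \<comment> \<open>For even r the denominator is alpha^r - beta^r, which is sqrt 5 times
    \<open>fib r\<close> by Binet. For odd r it is -alpha^r - beta^r, the negative of
    \<open>lucas r\<close>; \<open>neg\<close> extracts that sign so that the oddness of arctan
    applies.\<close>
  moreover have neg: "1 / (- a - b) = - (1 / (a + b))" for a b :: real
    by (simp add: minus_divide_right)
  ultimately have "arctan (x / (1 - x\<^sup>2)) =
      (if odd r then - arctan (1 / lucas r) else arctan (1 / (real (fib r) * sqrt 5)))"
    by (simp add: lucas_def fib_eq_Binet x_def neg arctan_minus)
  then show ?thesis
    using arctan_plus_arctan_cube_sums[OF x] arctan_plus_arctan_cube[OF x]
    by (simp add: pow beta flip: x_def)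
qed

end
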